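(* Let $k\geq 2$ be a fixed integer. Almost all graphs have $k$-color connection number $k$; that is, the proportion of labeled simple graphs on the vertex set $\{1,\dots,n\}$ with $cc_{k}(G)=k$ tends to $1$ as $n\to\infty$.
   Context: All graphs are finite, simple and undirected. An edge-coloring (not necessarily proper) of a graph is $k$-color connecting if between every pair of distinct vertices there is a path whose edges use at least $k$ different colors. $cc_{k}(G)$ is the minimum number of colors of a $k$-color connecting edge-coloring of $G$ (undefined if none exists). *)

theory Defs
  imports Complex_Main
begin

text \<open>A finite simple undirected graph is given by a finite vertex set \<open>V\<close> and a set \<open>E\<close> of
  two-element subsets of \<open>V\<close>.\<close>

definition simple_graph :: "'a set \<Rightarrow> 'a set set \<Rightarrow> bool" where
  "simple_graph V E \<longleftrightarrow> finite V \<and> E \<subseteq> {e. e \<subseteq> V \<and> card e = 2}"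

fun path_edges :: "'a list \<Rightarrow> 'a set set" where
  "path_edges [] = {}"
| "path_edges [x] = {}"
| "path_edges (x # y # xs) = insert {x, y} (path_edges (y # xs))"

text \<open>Paths do not repeat vertices; they are represented by their lists of vertices.\<close>

definition path_between :: "'a set \<Rightarrow> 'a set set \<Rightarrow> 'a \<Rightarrow> 'a list \<Rightarrow> 'a \<Rightarrow> bool" where
  "path_between V E u p v \<longleftrightarrow>
     p \<noteq> [] \<and> hd p = u \<and> last p = v \<and> distinct p \<and> set p \<subseteq> V \<and> path_edges p \<subseteq> E"

text \<open>An edge-coloring is a total function on vertex sets of which only the values on \<open>E\<close> matter.
  Since \<open>E\<close> is finite, natural numbers suffice as colors.\<close>

definition color_connecting :: "nat \<Rightarrow> 'a set \<Rightarrow> 'a set set \<Rightarrow> ('a set \<Rightarrow> nat) \<Rightarrow> bool" where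
  "color_connecting k V E c \<longleftrightarrow>
     (\<forall>u\<in>V. \<forall>v\<in>V. u \<noteq> v \<longrightarrow> (\<exists>p. path_between V E u p v \<and> k \<le> card (c ` path_edges p)))"

text \<open>The value \<open>None\<close> means that the number is undefined.\<close>

definition cc :: "nat \<Rightarrow> 'a set \<Rightarrow> 'a set set \<Rightarrow> nat option" where
  "cc k V E =
     (if \<exists>c. color_connecting k V E c
      then Some (LEAST m. \<exists>c. color_connecting k V E c \<and> card (c ` E) = m)
      else None)"

definition labeled_graphs :: "nat \<Rightarrow> nat set set set" where
  "labeled_graphs n = {E. simple_graph {1..n} E}"

end

theory Submission
  imports Defs "HOL-Library.Disjoint_Sets"
begin

text \<open>Color every edge by its smaller endpoint modulo \<open>k\<close>. A path running through \<open>k + 1\<close>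
  consecutive integers then sees all \<open>k\<close> colors, whatever its two end vertices are. Cut
  \<open>{1..n}\<close> into blocks of \<open>k + 1\<close> consecutive integers: for given \<open>u\<close> and \<open>v\<close>, the paths
  leading from \<open>u\<close> through one block to \<open>v\<close> are pairwise edge-disjoint, so all of them
  are missing from a random graph with probability at most \<open>(1 - 1 / 2 ^ (k + 2)) ^ (n div (k + 1) - 2)\<close>.
  The union bound over the fewer than \<open>n\<^sup>2\<close> pairs still tends to \<open>0\<close>. Conversely, \<open>k\<close> colors are
  necessary as soon as there are two vertices.\<close>

section \<open>Edges of paths\<close>

lemma path_edges_append:
  "path_edges (xs @ y # ys) = path_edges (xs @ [y]) \<union> path_edges (y # ys)"
proof (induction xs)
  case (Cons a xs)
  then show ?case by (cases xs) auto
qed simp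

lemma finite_path_edges: "finite (path_edges p)"
  by (induction p rule: path_edges.induct) auto

lemma card_path_edges: "card (path_edges p) \<le> length p - 1"
proof (induction p rule: path_edges.induct)
  case (3 x y xs)
  then show ?case
    using card_insert_le_m1[of "Suc (length xs)" "path_edges (y # xs)" "{x, y}"] by simp
qed simp_all

lemma path_edges_subset: "e \<in> path_edges p \<Longrightarrow> e \<subseteq> set p"
  by (induction p rule: path_edges.induct) auto

lemma card_path_edge: "distinct p \<Longrightarrow> e \<in> path_edges p \<Longrightarrow> card e = 2"
  by (induction p rule: path_edges.induct) auto

text \<open>Since \<open>xs\<close> is nonempty, \<open>u\<close> and \<open>v\<close> are never
  consecutive through the list, so every step starts or ends in \<open>xs\<close>. This is what
  makes paths through different blocks edge-disjoint.\<close>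

lemma path_edges_meet_inner:
  assumes "xs \<noteq> []" "e \<in> path_edges (u # xs @ [v])"
  shows "e \<inter> set xs \<noteq> {}"
  using assms
proof (induction xs arbitrary: u)
  case (Cons a xs)
  then show ?case by (cases xs) auto
qed simp

lemma path_edges_upt: "path_edges [a..<a + Suc n] = (\<lambda>i. {i, Suc i}) ` {a..<a + n}"
proof (induction n)
  case (Suc n)
  have "[a..<a + Suc (Suc n)] = [a..<a + n] @ (a + n) # [Suc (a + n)]"
    by simp
  moreover have "[a..<a + n] @ [a + n] = [a..<a + Suc n]"
    by simp
  ultimately have "path_edges [a..<a + Suc (Suc n)]
      = path_edges [a..<a + Suc n] \<union> path_edges [a + n, Suc (a + n)]"
    using path_edges_append[of "[a..<a + n]" "a + n" "[Suc (a + n)]"] by metis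
  also have "\<dots> = (\<lambda>i. {i, Suc i}) ` {a..<a + Suc n}"
    unfolding Suc by (auto simp: less_Suc_eq)
  finally show ?case .
qed simp

lemma path_edges_inner_subset: "path_edges xs \<subseteq> path_edges (u # xs @ [v])"
proof (cases xs)
  case (Cons a ys)
  have sub: "path_edges zs \<subseteq> path_edges (zs @ [v])" for zs :: "'a list"
    by (induction zs rule: path_edges.induct) auto
  show ?thesis using sub[of xs] Cons by auto
qed simp

section \<open>Coloring by the smaller endpoint\<close>

text \<open>Congruent members of the interval differ by a multiple of \<open>k\<close>, while
  distinct ones are less than \<open>k\<close> apart.\<close>

lemma image_mod_interval: "card ((\<lambda>i. i mod k) ` {a..<a + k}) = (k::nat)"
proof -
  have "inj_on (\<lambda>i. i mod k) {a..<a + k}"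
  proof (rule linorder_inj_onI)
    fix x y assume xy: "x < y" "x \<in> {a..<a + k}" "y \<in> {a..<a + k}"
    show "x mod k \<noteq> y mod k"
    proof
      assume "x mod k = y mod k"
      then have "k dvd y - x"
        using xy by (metis less_imp_le_nat mod_eq_dvd_iff_nat)
      then show False
        using xy by (auto dest!: dvd_imp_le)
    qed
  qed auto
  then show ?thesis by (simp add: card_image)
qed

text \<open>The \<open>k\<close> edges inside the interval have smaller endpoints \<open>a\<close>,
  ..., \<open>a + k - 1\<close>, which represent every residue modulo \<open>k\<close>. The two
  outer edges can only add colors, so nothing is asked of \<open>u\<close> and
  \<open>v\<close>.\<close>

lemma many_colors_through_interval:
  "k \<le> card ((\<lambda>e. Min e mod k) ` path_edges (u # [a..<a + Suc k] @ [v]))"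
proof -
  have "(\<lambda>i. i mod k) ` {a..<a + k} = (\<lambda>e. Min e mod k) ` path_edges [a..<a + Suc k]"
    unfolding path_edges_upt image_image by (rule image_cong) simp_all
  then have "(\<lambda>i. i mod k) ` {a..<a + k}
      \<subseteq> (\<lambda>e. Min e mod k) ` path_edges (u # [a..<a + Suc k] @ [v])"
    by (simp only: image_mono path_edges_inner_subset)
  then have "card ((\<lambda>i. i mod k) ` {a..<a + k})
      \<le> card ((\<lambda>e. Min e mod k) ` path_edges (u # [a..<a + Suc k] @ [v]))"
    by (intro card_mono finite_imageI finite_path_edges)
  then show ?thesis by (simp only: image_mod_interval)
qed

section \<open>At least \<open>k\<close> colors are necessary\<close>

lemma color_connecting_card_ge:
  assumes "color_connecting k V E c" "finite E" "u \<in> V" "v \<in> V" "u \<noteq> v"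
  shows "k \<le> card (c ` E)"
proof -
  obtain p where p: "path_edges p \<subseteq> E" "k \<le> card (c ` path_edges p)"
    using assms unfolding color_connecting_def path_between_def by blast
  have "card (c ` path_edges p) \<le> card (c ` E)"
    using p(1) assms(2) by (intro card_mono) auto
  with p(2) show ?thesis by simp
qed

text \<open>The given coloring attains \<open>k\<close>; the distinct vertices \<open>u\<close> and
  \<open>v\<close> supply the matching lower bound for every competing coloring.\<close>

lemma cc_eqI:
  assumes c: "color_connecting k V E c" "card (c ` E) \<le> k"
    and "finite E" "u \<in> V" "v \<in> V" "u \<noteq> v"
  shows "cc k V E = Some k"
proof -
  have "k \<le> card (c' ` E)" if "color_connecting k V E c'" for c'
    using color_connecting_card_ge[OF that] assms(3-) by blast
  then have "(LEAST m. \<exists>c. color_connecting k V E c \<and> card (c ` E) = m) = k"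
    using c by (intro Least_equality) (use le_antisym in blast)+
  then show ?thesis
    using c unfolding cc_def by auto
qed

section \<open>Subsets avoiding a disjoint family\<close>

text \<open>A uniformly random subset of \<open>S\<close> contains \<open>P j\<close> with
  probability at least \<open>1 / 2 ^ s\<close>, and these events are independent because the sets
  \<open>P j\<close> are disjoint. The induction turns this into counting by removing one
  \<open>P i\<close> from \<open>S\<close> at a time, so \<open>S\<close> has to vary.\<close>

lemma card_subsets_avoiding_disjoint:
  fixes P :: "'i \<Rightarrow> 'a set"
  assumes "finite J" "finite S" "\<And>j. j \<in> J \<Longrightarrow> P j \<subseteq> S" "\<And>j. j \<in> J \<Longrightarrow> card (P j) \<le> s"
    and "disjoint_family_on P J"
  shows "real (card {E \<in> Pow S. \<forall>j\<in>J. \<not> P j \<subseteq> E}) \<le> (1 - 1 / 2 ^ s) ^ card J * 2 ^ card S"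
  using assms
proof (induction J arbitrary: S rule: finite_induct)
  case empty
  then show ?case by (simp flip: Pow_def add: card_Pow)
next
  case (insert i J)
  define T where "T = S - P i"
  define A where "A = {E \<in> Pow S. \<forall>j\<in>insert i J. \<not> P j \<subseteq> E}"
  define B where "B = {E \<in> Pow T. \<forall>j\<in>J. \<not> P j \<subseteq> E}"
  have disj: "P i \<inter> P j = {}" if "j \<in> J" for j
    using insert.prems(4) insert.hyps(2) that unfolding disjoint_family_on_def by auto
  have finP: "finite (P i)" and finT: "finite T"
    using insert.prems(1) finite_subset[OF insert.prems(2)] unfolding T_def by auto
  have "card S = card (P i) + card T"
    using insert.prems(2)[of i] insert.prems(1) finP unfolding T_def
    by (simp add: card_Diff_subset card_mono)
  then have cardS: "(2::real) ^ card S = 2 ^ card (P i) * 2 ^ card T"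
    by (simp add: power_add)
  have IH: "real (card B) \<le> (1 - 1 / 2 ^ s) ^ card J * 2 ^ card T"
    unfolding B_def
  proof (rule insert.IH)
    show "P j \<subseteq> T" if "j \<in> J" for j
      using insert.prems(2)[of j] disj[OF that] that unfolding T_def by blast
  qed (use insert.prems finT in \<open>auto simp: disjoint_family_on_def\<close>)
  \<comment> \<open>Split \<open>E\<close> into its trace on \<open>P i\<close>, which is not all of
    \<open>P i\<close>, and the rest in \<open>T\<close>, which still avoids every other
    \<open>P j\<close> because these lie in \<open>T\<close>.\<close>
  have "card A \<le> card ((Pow (P i) - {P i}) \<times> B)"
  proof (rule card_inj_on_le)
    show "inj_on (\<lambda>E. (E \<inter> P i, E - P i)) A"
      by (rule inj_onI) blast
    show "(\<lambda>E. (E \<inter> P i, E - P i)) ` A \<subseteq> (Pow (P i) - {P i}) \<times> B"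
      using disj unfolding A_def B_def T_def by fastforce
    show "finite ((Pow (P i) - {P i}) \<times> B)"
      using finP finT unfolding B_def by simp
  qed
  also have "\<dots> = (2 ^ card (P i) - 1) * card B"
    using finP by (simp add: card_cartesian_product card_Diff_singleton card_Pow)
  finally have "real (card A) \<le> (2 ^ card (P i) - 1) * real (card B)"
    by (metis (mono_tags) of_nat_mono of_nat_mult of_nat_diff of_nat_power of_nat_numeral of_nat_1
        one_le_numeral one_le_power)
  also have "\<dots> \<le> ((1 - 1 / 2 ^ s) * 2 ^ card (P i)) * real (card B)"
  proof (rule mult_right_mono)
    \<comment> \<open>Sets smaller than \<open>s\<close> are contained even more often, so the
      factor for size \<open>s\<close> covers them.\<close>
    have "(2::real) ^ card (P i) \<le> 2 ^ s"
      using insert.prems(3) by (simp add: power_increasing)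
    then show "(2::real) ^ card (P i) - 1 \<le> (1 - 1 / 2 ^ s) * 2 ^ card (P i)"
      by (simp add: field_simps)
  qed simp
  also have "\<dots> \<le> ((1 - 1 / 2 ^ s) * 2 ^ card (P i)) * ((1 - 1 / 2 ^ s) ^ card J * 2 ^ card T)"
    by (rule mult_left_mono[OF IH]) simp
  also have "\<dots> = (1 - 1 / 2 ^ s) ^ card (insert i J) * 2 ^ card S"
    using insert.hyps unfolding cardS by (simp add: mult_ac)
  finally show ?case unfolding A_def .
qed

section \<open>The random graph\<close>

lemma labeled_graphs_eq_Pow: "labeled_graphs n = Pow {e. e \<subseteq> {1..n} \<and> card e = 2}"
  unfolding labeled_graphs_def simple_graph_def by auto

text \<open>A path through one block has \<open>k + 3\<close> vertices, hence at most
  \<open>k + 2\<close> edges; at most two of the \<open>n div Suc k\<close> full blocks are lost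
  because they contain \<open>u\<close> or \<open>v\<close>.\<close>

lemma card_graphs_without_rainbow_path:
  assumes uv: "u \<in> {1..n}" "v \<in> {1..n}" "u \<noteq> v"
  shows "real (card {E \<in> labeled_graphs n.
            \<not> (\<exists>p. path_between {1..n} E u p v \<and> k \<le> card ((\<lambda>e. Min e mod k) ` path_edges p))})
         \<le> (1 - 1 / 2 ^ (k + 2)) ^ (n div Suc k - 2) * real (card (labeled_graphs n))"
    (is "real (card ?bad) \<le> _")
proof -
  define S where "S = {e. e \<subseteq> {1..n} \<and> card e = 2}"
  have finS: "finite S" unfolding S_def by simp
  define d where "d = Suc k"
  \<comment> \<open>Vertices start at 1, so block \<open>j\<close> begins at
    \<open>j * d + 1\<close> and a vertex \<open>x\<close> has block index
    \<open>(x - 1) div d\<close>.\<close>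
  define block where "block j = [Suc (j * d)..<Suc (j * d) + Suc k]" for j
  define p where "p j = u # block j @ [v]" for j
  define J where "J = {..<n div d} - {(u - 1) div d, (v - 1) div d}"
  have set_block: "set (block j) = {Suc (j * d)..j * d + d}" for j
    unfolding block_def d_def by auto
  have block_ne: "block j \<noteq> []" for j
    unfolding block_def by simp
  have block_index: "(x - 1) div d = j" if "x \<in> set (block j)" for x j
    using that unfolding set_block by (intro div_nat_eqI) (auto simp: d_def mult.commute)
  have uv_out: "u \<notin> set (block j)" "v \<notin> set (block j)" if "j \<in> J" for j
    using block_index that unfolding J_def by blast+
  have dist: "distinct (p j)" if "j \<in> J" for j
    using uv_out[OF that] uv(3) unfolding p_def by (auto simp: block_def)
  have in_V: "set (p j) \<subseteq> {1..n}" if "j \<in> J" for j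
  proof -
    have "Suc j \<le> n div d" using that unfolding J_def by auto
    then have "Suc j * d \<le> n div d * d" by (rule mult_le_mono1)
    also have "\<dots> \<le> n" by (rule div_times_less_eq_dividend)
    finally have "j * d + d \<le> n" by simp
    then show ?thesis using uv(1,2) unfolding p_def by (auto simp: set_block)
  qed
  have sub: "path_edges (p j) \<subseteq> S" if "j \<in> J" for j
    using path_edges_subset[of _ "p j"] card_path_edge[OF dist[OF that]] in_V[OF that]
    unfolding S_def by blast
  have card_le: "card (path_edges (p j)) \<le> k + 2" for j
    using card_path_edges[of "p j"] by (simp add: p_def block_def del: upt_Suc)
  have disj: "disjoint_family_on (\<lambda>j. path_edges (p j)) J"
    unfolding disjoint_family_on_def
  proof (intro ballI impI equals0I)
    \<comment> \<open>A common edge would have an endpoint in block \<open>i\<close>. This endpoint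
      is neither \<open>u\<close> nor \<open>v\<close>, so it would also lie in block
      \<open>j\<close>.\<close>
    fix i j e assume ij: "i \<in> J" "j \<in> J" "i \<noteq> j" and e: "e \<in> path_edges (p i) \<inter> path_edges (p j)"
    obtain x where x: "x \<in> e" "x \<in> set (block i)"
      using path_edges_meet_inner[OF block_ne] e unfolding p_def by blast
    have "x \<in> set (p j)" using e x(1) path_edges_subset by blast
    then have "x \<in> set (block j)"
      using x(2) uv_out[OF ij(1)] unfolding p_def by auto
    then show False using block_index x(2) ij(3) by blast
  qed
  have "?bad \<subseteq> {E \<in> Pow S. \<forall>j\<in>J. \<not> path_edges (p j) \<subseteq> E}"
  proof safe
    fix E e assume "E \<in> labeled_graphs n" "e \<in> E"
    then show "e \<in> S" unfolding labeled_graphs_eq_Pow S_def by blast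
  next
    fix E j
    assume none: "\<nexists>p. path_between {1..n} E u p v \<and> k \<le> card ((\<lambda>e. Min e mod k) ` path_edges p)"
      and j: "j \<in> J" "path_edges (p j) \<subseteq> E"
    have "path_between {1..n} E u (p j) v"
      using j(2) dist[OF j(1)] in_V[OF j(1)] unfolding path_between_def by (simp add: p_def)
    moreover have "k \<le> card ((\<lambda>e. Min e mod k) ` path_edges (p j))"
      unfolding p_def block_def by (rule many_colors_through_interval)
    ultimately show False using none by blast
  qed
  then have "card ?bad \<le> card {E \<in> Pow S. \<forall>j\<in>J. \<not> path_edges (p j) \<subseteq> E}"
    using finS by (intro card_mono) auto
  also have "real \<dots> \<le> (1 - 1 / 2 ^ (k + 2)) ^ card J * 2 ^ card S"
    using sub card_le disj finS
    by (intro card_subsets_avoiding_disjoint) (auto simp: J_def)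
  also have "\<dots> \<le> (1 - 1 / 2 ^ (k + 2)) ^ (n div d - 2) * 2 ^ card S"
  proof (rule mult_right_mono[OF power_decreasing])
    \<comment> \<open>\<open>u\<close> and \<open>v\<close> may share a block or lie beyond the last
      full one, so \<open>card J\<close> is only bounded below. A base in [0, 1] makes this the
      useful direction.\<close>
    have "card {(u - 1) div d, (v - 1) div d} \<le> 2"
      by (simp add: card_insert_if)
    then have "n div d - 2 \<le> card {..<n div d} - card {(u - 1) div d, (v - 1) div d}"
      unfolding card_lessThan by (rule diff_le_mono2)
    also have "\<dots> \<le> card J"
      unfolding J_def by (rule diff_card_le_card_Diff) simp
    finally show "n div d - 2 \<le> card J" .
    have "(1::real) \<le> 2 ^ (k + 2)"
      by (rule one_le_power) simp
    then show "0 \<le> 1 - 1 / (2::real) ^ (k + 2)"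
      by (simp add: field_simps)
  qed simp_all
  also have "(2::real) ^ card S = real (card (labeled_graphs n))"
    using finS unfolding labeled_graphs_eq_Pow S_def by (simp add: card_Pow)
  finally show ?thesis unfolding d_def by simp
qed

text \<open>Union bound over ordered pairs: if no pair is bad, the coloring by
  \<open>Min e mod k\<close> is connecting, and \<open>k > 0\<close> keeps its colors below
  \<open>k\<close>. Only an inclusion holds, as a graph with a bad pair may have another suitable
  coloring.\<close>

lemma card_graphs_cc_neq:
  assumes "n \<ge> 2" "k > 0"
  shows "real (card {E \<in> labeled_graphs n. cc k {1..n} E \<noteq> Some k})
         \<le> real n ^ 2 * (1 - 1 / 2 ^ (k + 2)) ^ (n div Suc k - 2) * real (card (labeled_graphs n))"
proof -
  define D where "D = {1..n} \<times> {1..n} - Id"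
  define bad where "bad = (\<lambda>(u, v). {E \<in> labeled_graphs n.
      \<not> (\<exists>p. path_between {1..n} E u p v \<and> k \<le> card ((\<lambda>e. Min e mod k) ` path_edges p))})"
  define q :: real where "q = (1 - 1 / 2 ^ (k + 2)) ^ (n div Suc k - 2)"
  have fin: "finite (labeled_graphs n)"
    unfolding labeled_graphs_eq_Pow by simp
  have "{E \<in> labeled_graphs n. cc k {1..n} E \<noteq> Some k} \<subseteq> (\<Union>x\<in>D. bad x)"
  proof (rule subsetI, rule ccontr)
    fix E assume E: "E \<in> {E \<in> labeled_graphs n. cc k {1..n} E \<noteq> Some k}" "E \<notin> (\<Union>x\<in>D. bad x)"
    have "color_connecting k {1..n} E (\<lambda>e. Min e mod k)"
      using E unfolding color_connecting_def bad_def D_def by auto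
    moreover have "card ((\<lambda>e. Min e mod k) ` E) \<le> k"
    proof -
      have "(\<lambda>e. Min e mod k) ` E \<subseteq> {..<k}"
        using assms(2) by auto
      then show ?thesis
        using card_mono[of "{..<k}"] by fastforce
    qed
    moreover have "finite E"
      using E(1) finite_subset[of E] unfolding labeled_graphs_eq_Pow by fastforce
    ultimately have "cc k {1..n} E = Some k"
      \<comment> \<open>As \<open>n \<ge> 2\<close>, the vertices 1 and 2 serve as the required
        distinct pair.\<close>
      using assms(1) by (intro cc_eqI[of _ _ _ _ 1 2]) auto
    then show False using E(1) by simp
  qed
  then have "card {E \<in> labeled_graphs n. cc k {1..n} E \<noteq> Some k} \<le> card (\<Union>x\<in>D. bad x)"
    using fin by (intro card_mono) (auto simp: D_def bad_def)
  also have "\<dots> \<le> (\<Sum>x\<in>D. card (bad x))"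
    by (rule card_UN_le) (simp add: D_def)
  also have "real \<dots> \<le> (\<Sum>x\<in>D. q * real (card (labeled_graphs n)))"
    unfolding of_nat_sum
  proof (rule sum_mono)
    fix x assume "x \<in> D"
    then obtain u v where "x = (u, v)" and uv: "u \<in> {1..n}" "v \<in> {1..n}" "u \<noteq> v"
      unfolding D_def by blast
    then show "real (card (bad x)) \<le> q * real (card (labeled_graphs n))"
      using card_graphs_without_rainbow_path[OF uv, of k] unfolding bad_def q_def by simp
  qed
  also have "\<dots> = real (card D) * (q * real (card (labeled_graphs n)))"
    by simp
  also have "\<dots> \<le> real n ^ 2 * (q * real (card (labeled_graphs n)))"
  proof (rule mult_right_mono)
    have "card D \<le> card ({1..n} \<times> {1..n})"
      unfolding D_def by (intro card_mono) auto
    then have "real (card D) \<le> real (n * n)"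
      unfolding of_nat_le_iff by simp
    then show "real (card D) \<le> real n ^ 2"
      by (simp add: power2_eq_square)
    have "(1::real) \<le> 2 ^ (k + 2)"
      by (rule one_le_power) simp
    then show "0 \<le> q * real (card (labeled_graphs n))"
      unfolding q_def by (intro mult_nonneg_nonneg zero_le_power) (simp_all add: field_simps)
  qed
  finally show ?thesis unfolding q_def by (simp add: mult_ac)
qed

section \<open>Asymptotics and conclusion\<close>

lemma square_times_power_div_tendsto_0:
  fixes q :: real
  assumes q: "0 < q" "q < 1" and d: "d > 0"
  shows "(\<lambda>n. real n ^ 2 * q ^ (n div d - a)) \<longlonglongrightarrow> 0"
proof -
  have lin: "(\<lambda>m. real m * r ^ m) \<longlonglongrightarrow> 0" if "0 < r" "r < 1" for r :: real
    using powser_times_n_limit_0[of r] that by simp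
  \<comment> \<open>The square root reduces the quadratic factor to the linear limit
    \<open>lin\<close>: \<open>(m + 1) ^ 2 * q ^ m\<close> is the square of
    \<open>m * r ^ m + r ^ m\<close>.\<close>
  define r where "r = sqrt q"
  have r: "0 < r" "r < 1" "q = r ^ 2" using q unfolding r_def by auto
  have "(\<lambda>m. (real m * r ^ m + r ^ m) ^ 2) \<longlonglongrightarrow> (0 + 0) ^ 2"
    using r by (intro tendsto_intros lin LIMSEQ_power_zero) auto
  moreover have "(real m * r ^ m + r ^ m) ^ 2 = (real m + 1) ^ 2 * q ^ m" for m
  proof -
    have "real m * r ^ m + r ^ m = (real m + 1) * r ^ m"
      by (simp add: algebra_simps)
    then show ?thesis
      unfolding r(3) by (simp add: power_mult_distrib power_mult [symmetric] mult.commute)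
  qed
  ultimately have "(\<lambda>m. (real m + 1) ^ 2 * q ^ m) \<longlonglongrightarrow> 0"
    by simp
  moreover have "filterlim (\<lambda>n. n div d) sequentially sequentially"
    using d by (intro filterlim_at_top[THEN iffD2] allI)
      (auto simp: eventually_sequentially less_eq_div_iff_mult_less_eq)
  ultimately have "(\<lambda>n. (real (n div d) + 1) ^ 2 * q ^ (n div d)) \<longlonglongrightarrow> 0"
    by (rule filterlim_compose)
  then have "(\<lambda>n. real d ^ 2 / q ^ a * ((real (n div d) + 1) ^ 2 * q ^ (n div d))) \<longlonglongrightarrow> 0"
    by (rule tendsto_mult_right_zero)
  then show ?thesis
  proof (rule tendsto_sandwich[OF _ _ tendsto_const, rotated 2])
    show "\<forall>\<^sub>F n in sequentially. 0 \<le> real n ^ 2 * q ^ (n div d - a)"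
      using q by simp
    show "\<forall>\<^sub>F n in sequentially. real n ^ 2 * q ^ (n div d - a)
        \<le> real d ^ 2 / q ^ a * ((real (n div d) + 1) ^ 2 * q ^ (n div d))"
    proof (intro always_eventually allI)
      fix n
      \<comment> \<open>This trades \<open>n\<close> for \<open>m = n div d\<close>, so that the
        limit in \<open>m\<close> can be used.\<close>
      have "n \<le> d * (n div d + 1)"
        using dividend_less_times_div[of d n] d by simp
      then have "real n \<le> real (d * (n div d + 1))"
        by (simp only: of_nat_le_iff)
      then have "real n ^ 2 \<le> (real d * (real (n div d) + 1)) ^ 2"
        by (intro power_mono) (auto simp: algebra_simps)
      \<comment> \<open>Equality holds for \<open>a \<le> n div d\<close>; otherwise the truncated
        exponent is 0 and the right side is at least 1.\<close>
      moreover have "q ^ (n div d - a) \<le> q ^ (n div d) / q ^ a"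
      proof (cases "a \<le> n div d")
        case True
        then show ?thesis using q by (simp add: power_diff)
      next
        case False
        then have "q ^ a \<le> q ^ (n div d)" using q by (intro power_decreasing) auto
        then show ?thesis using False q by (simp add: field_simps)
      qed
      ultimately have "real n ^ 2 * q ^ (n div d - a)
          \<le> (real d * (real (n div d) + 1)) ^ 2 * (q ^ (n div d) / q ^ a)"
        using q by (intro mult_mono) auto
      then show "real n ^ 2 * q ^ (n div d - a)
        \<le> real d ^ 2 / q ^ a * ((real (n div d) + 1) ^ 2 * q ^ (n div d))"
        by (simp add: power_mult_distrib mult_ac)
    qed
  qed
qed

theorem theorem3p7:
  fixes k :: nat
  assumes "k \<ge> 2"
  shows "(\<lambda>n. real (card {E \<in> labeled_graphs n. cc k {1..n} E = Some k})
              / real (card (labeled_graphs n))) \<longlonglongrightarrow> 1"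
proof -
  define f where "f n = real n ^ 2 * (1 - 1 / 2 ^ (k + 2)) ^ (n div Suc k - 2)" for n
  have "f \<longlonglongrightarrow> 0"
    unfolding f_def
  proof (rule square_times_power_div_tendsto_0)
    have "(1::real) < 2 ^ (k + 2)" by (rule one_less_power) auto
    then show "0 < 1 - 1 / (2::real) ^ (k + 2)" by simp
  qed simp_all
  then have "(\<lambda>n. 1 - f n) \<longlonglongrightarrow> 1"
    using tendsto_diff[OF tendsto_const] by fastforce
  then show ?thesis
  proof (rule tendsto_sandwich[OF _ _ _ tendsto_const, rotated 2])
    \<comment> \<open>For \<open>n < 2\<close> there is no pair to connect and \<open>cc\<close> is
      \<open>Some 0\<close>, so the estimates start at \<open>n = 2\<close>.\<close>
    have lower: "1 - f n \<le> real (card {E \<in> labeled_graphs n. cc k {1..n} E = Some k})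
              / real (card (labeled_graphs n))"
      and upper: "real (card {E \<in> labeled_graphs n. cc k {1..n} E = Some k})
              / real (card (labeled_graphs n)) \<le> 1"
      if "n \<ge> 2" for n
    proof -
      let ?L = "labeled_graphs n"
      let ?G = "{E \<in> ?L. cc k {1..n} E = Some k}" and ?B = "{E \<in> ?L. cc k {1..n} E \<noteq> Some k}"
      have fin: "finite ?L" and ne: "?L \<noteq> {}"
        unfolding labeled_graphs_eq_Pow by auto
      then have pos: "real (card ?L) > 0"
        by (simp add: card_gt_0_iff)
      have "?L = ?G \<union> ?B" by blast
      then have "card ?L = card ?G + card ?B"
        using fin card_Un_disjoint[of ?G ?B] by fastforce
      moreover have "real (card ?B) \<le> f n * real (card ?L)"
        unfolding f_def using assms that by (intro card_graphs_cc_neq) auto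
      ultimately show "1 - f n \<le> real (card ?G) / real (card ?L)"
        and "real (card ?G) / real (card ?L) \<le> 1"
        using pos by (auto simp: field_simps)
    qed
    show "\<forall>\<^sub>F n in sequentially. 1 - f n \<le> real (card {E \<in> labeled_graphs n. cc k {1..n} E = Some k})
              / real (card (labeled_graphs n))"
      using eventually_ge_at_top[of 2] by eventually_elim (rule lower)
    show "\<forall>\<^sub>F n in sequentially. real (card {E \<in> labeled_graphs n. cc k {1..n} E = Some k})
              / real (card (labeled_graphs n)) \<le> 1"
      using eventually_ge_at_top[of 2] by eventually_elim (rule upper)
  qed
qed

end
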